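(* Consider the normal means problem $P_\theta=\mathcal N(\theta,1)$, $\theta\in\mathbb R$. There exists a universal constant $c_0>0$ such that for any $s>0$ (and any sample size $n$), $$\mathsf{TotRegretComp}_n(\mathsf{SubG}(s))\ \ge\ \mathsf{TotRegret}_n(\mathsf{SubG}(c_0s))-\frac{s}{c_0n},$$ where $\mathsf{SubG}(s)=\{G:\ G([-t,t]^c)\le 2e^{-t^2/(2s)}\ \ \forall t>0\}$ is the set of $s$-subgaussian probability distributions on $\mathbb R$.
   Context: Conditioned on $\theta^n=(\theta_1,\dots,\theta_n)$, the observations $Y_1,\dots,Y_n$ are independent with $Y_i\sim P_{\theta_i}$. $\|\cdot\|$ is the Euclidean norm. For a prior $G$: $\mathrm{mmse}(G)=\inf_{\hat\theta}\mathbb E_G[(\hat\theta(Y)-\theta)^2]$ with $\theta\sim G$, $Y\mid\theta\sim P_\theta$. Empirical Bayes regret over a class $\mathcal G$ of priors: $$\mathsf{TotRegret}_n(\mathcal G)=\inf_{\hat\theta^n}\sup_{G\in\mathcal G}\{\mathbb E_G[\|\hat\theta^n(Y^n)-\theta^n\|^2]-n\,\mathrm{mmse}(G)\},$$ where under $\mathbb E_G$ the $\theta_i$ are i.i.d. from $G$. Compound regret over a class $\mathcal G$: $$\mathsf{TotRegretComp}_n(\mathcal G)=\inf_{\hat\theta^n}\ \sup_{\theta^n\in\mathbb R^n:\ G_{\theta^n}\in\mathcal G}\{\mathbb E_{\theta^n}[\|\hat\theta^n(Y^n)-\theta^n\|^2]-n\,\mathrm{mmse}(G_{\theta^n})\},$$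 where $\theta^n$ is deterministic and $G_{\theta^n}=\frac1n\sum_{i=1}^n\delta_{\theta_i}$ is its empirical distribution. Infima are over all estimators that are functions of $Y^n$. *)

theory Defs
  imports "HOL-Probability.Probability"
begin

text \<open>
  Vectors in $\mathbb R^n$ are functions on the index set \<open>{..<n}\<close>, extended by
  \<open>undefined\<close> outside of it, as in the product spaces \<open>Pi\<^sub>M {..<n} M\<close>; their Euclidean
  norm is \<open>L2_set _ {..<n}\<close>. A statistical model is a family \<open>P\<close> of laws on the Borel
  space of the reals, indexed by the parameter. Expected squared losses are computed in
  \<open>ennreal\<close>, so that they are meaningful for every measurable estimator; regrets are
  signed and live in \<open>ereal\<close>.
\<close>

definition estimators :: "nat \<Rightarrow> ((nat \<Rightarrow> real) \<Rightarrow> (nat \<Rightarrow> real)) set" where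
  "estimators n =
     measurable (Pi\<^sub>M {..<n} (\<lambda>_. borel :: real measure)) (Pi\<^sub>M {..<n} (\<lambda>_. borel :: real measure))"

definition compound_risk ::
  "(real \<Rightarrow> real measure) \<Rightarrow> nat \<Rightarrow> ((nat \<Rightarrow> real) \<Rightarrow> (nat \<Rightarrow> real)) \<Rightarrow> (nat \<Rightarrow> real) \<Rightarrow> ennreal" where
  "compound_risk P n est \<theta> =
     (\<integral>\<^sup>+ y. ennreal ((L2_set (\<lambda>i. est y i - \<theta> i) {..<n})\<^sup>2) \<partial>Pi\<^sub>M {..<n} (\<lambda>i. P (\<theta> i)))"

definition bayes_risk ::
  "(real \<Rightarrow> real measure) \<Rightarrow> nat \<Rightarrow> ((nat \<Rightarrow> real) \<Rightarrow> (nat \<Rightarrow> real)) \<Rightarrow> real measure \<Rightarrow> ennreal" where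
  "bayes_risk P n est G = (\<integral>\<^sup>+ \<theta>. compound_risk P n est \<theta> \<partial>Pi\<^sub>M {..<n} (\<lambda>_. G))"

definition mmse :: "(real \<Rightarrow> real measure) \<Rightarrow> real measure \<Rightarrow> ennreal" where
  "mmse P G =
     (INF f \<in> borel_measurable (borel :: real measure).
        \<integral>\<^sup>+ \<theta>. (\<integral>\<^sup>+ y. ennreal ((f y - \<theta>)\<^sup>2) \<partial>P \<theta>) \<partial>G)"

text \<open>
  In \<open>ereal\<close> one has \<open>\<infinity> - \<infinity> = \<infinity>\<close>. This case does not arise below for the normal means
  model, where the estimator \<open>f y = y\<close> shows that \<open>mmse P G \<le> 1\<close> for every prior \<open>G\<close>.
\<close>

definition TotRegret :: "(real \<Rightarrow> real measure) \<Rightarrow> nat \<Rightarrow> real measure set \<Rightarrow> ereal" where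
  "TotRegret P n \<G> =
     (INF est \<in> estimators n. SUP G \<in> \<G>.
        enn2ereal (bayes_risk P n est G) - ereal (real n) * enn2ereal (mmse P G))"

definition empirical :: "nat \<Rightarrow> (nat \<Rightarrow> real) \<Rightarrow> real measure" where
  "empirical n \<theta> = distr (uniform_count_measure {..<n}) borel \<theta>"

lemma emeasure_empirical:
  assumes "n \<ge> 1" and "A \<in> sets borel"
  shows "emeasure (empirical n \<theta>) A = (\<Sum>i<n. emeasure (return borel (\<theta> i)) A) / of_nat n"
proof -
  have "emeasure (empirical n \<theta>) A = emeasure (uniform_count_measure {..<n}) (\<theta> -` A \<inter> {..<n})"
    using assms unfolding empirical_def
    by (subst emeasure_distr) (auto simp: space_uniform_count_measure sets_uniform_count_measure measurable_def)
  also have "\<dots> = ennreal (real (card (\<theta> -` A \<inter> {..<n})) / real n)"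
    by (subst emeasure_uniform_count_measure) auto
  also have "real (card (\<theta> -` A \<inter> {..<n})) = (\<Sum>i<n. indicator A (\<theta> i))"
    by (simp add: indicator_def sum.If_cases Int_def vimage_def conj_commute)
  also have "ennreal ((\<Sum>i<n. indicator A (\<theta> i)) / real n) = (\<Sum>i<n. indicator A (\<theta> i)) / of_nat n"
    using assms(1)
    by (subst divide_ennreal[symmetric])
       (auto simp: sum_nonneg ennreal_of_nat_eq_real_of_nat ennreal_indicator simp flip: sum_ennreal)
  finally show ?thesis
    using assms(2) by simp
qed

definition TotRegretComp :: "(real \<Rightarrow> real measure) \<Rightarrow> nat \<Rightarrow> real measure set \<Rightarrow> ereal" where
  "TotRegretComp P n \<G> =
     (INF est \<in> estimators n. SUP \<theta> \<in> {\<theta> \<in> {..<n} \<rightarrow>\<^sub>E UNIV. empirical n \<theta> \<in> \<G>}.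
        enn2ereal (compound_risk P n est \<theta>) - ereal (real n) * enn2ereal (mmse P (empirical n \<theta>)))"

definition normal_means :: "real \<Rightarrow> real measure" where
  "normal_means \<theta> = density lborel (normal_density \<theta> 1)"

definition SubG :: "real \<Rightarrow> real measure set" where
  "SubG s = {G. sets G = sets borel \<and> prob_space G \<and>
                (\<forall>t>0. measure G (- {-t..t}) \<le> 2 * exp (- t\<^sup>2 / (2 * s)))}"

end

theory Submission
  imports Defs
begin

text \<open>
  A compound estimator with small regret over \<open>SubG s\<close> is also a good Bayes estimator for a
  prior \<open>G\<close> in \<open>SubG (c0 * s)\<close>, because an i.i.d. sample \<open>\<theta>\<close> from \<open>G\<close> has its empirical law in
  \<open>SubG s\<close> except on a very rare event. Off that event the compound risk at \<open>\<theta>\<close> is at most the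
  compound regret \<open>\<rho>\<close> plus \<open>n * mmse (empirical n \<theta>)\<close>. Averaging the second term over the sample
  costs nothing: for a fixed scalar rule \<open>f\<close>, \<open>n * mmse (empirical n \<theta>)\<close> is at most the sum of the
  risks of \<open>f\<close> at the \<open>\<theta> i\<close>, whose mean is \<open>n\<close> times the risk of \<open>f\<close> under \<open>G\<close>, and the infimum
  over \<open>f\<close> is taken last. Replacing \<open>\<rho>\<close> on part of the space by \<open>\<rho>\<close> on the whole space is harmless
  too, since \<open>\<rho> \<ge> 0\<close>: at \<open>\<theta> = 0\<close> the minimum mean squared error vanishes, so the regret is a risk.

  The work lies in the rare event, where the estimator could be arbitrarily bad. Let
  \<open>X t = exp (t\<^sup>2 / (2 * s))\<close>. By Markov's inequality for the empirical law, \<open>(\<Sum>i<n. X (\<theta> i)) \<le> 2 * n\<close>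
  puts it in \<open>SubG s\<close>, and it also forces \<open>\<bar>\<theta> i\<bar> \<le> 2 * sqrt (s * n)\<close>. Hence clipping the
  estimator at that level does not hurt it on the good event, and everywhere it bounds the loss by
  a constant times \<open>s * (n\<^sup>2 + (\<Sum>i<n. X (\<theta> i)))\<close>. The event has to have probability of order \<open>n\<^sup>-\<^sup>3\<close>
  in order to leave an error of order \<open>s / n\<close>. Taking \<open>c0\<close> small makes high moments of \<open>X\<close> finite,
  with a mean below \<open>3/2\<close>, and the event splits in two. If some \<open>X (\<theta> i)\<close> exceeds \<open>root 4 n\<close>, its
  high power pays for all factors of \<open>n\<close> (\<open>sum_le_truncated_or_power\<close>). Otherwise the sum
  of the variables truncated at \<open>root 4 n\<close> exceeds its mean by \<open>n / 2\<close>, which by Hoeffding's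
  inequality has probability at most \<open>exp (- sqrt n / 2)\<close> (\<open>prob_truncated_sum_gt_le\<close>).
  \<open>compound_risk_clip_bound\<close> collects the cases into one pointwise bound by measurable
  functions of \<open>\<theta>\<close>, and \<open>bayes_risk_clip_bound\<close> integrates it.
\<close>

section \<open>Exponential moments of subgaussian laws\<close>

lemma SubG_imp_prob_space: "G \<in> SubG s \<Longrightarrow> prob_space G"
  and SubG_imp_sets: "G \<in> SubG s \<Longrightarrow> sets G = sets borel"
  by (auto simp: SubG_def)

lemma le_dyadic_layers:
  fixes v :: real
  shows "ennreal v \<le> 1 + (\<Sum>j. ennreal (2 ^ Suc j) * indicator {2 ^ j<..} v)"
proof (cases "v \<le> 1")
  case True
  then have "ennreal v \<le> 1"
    by simp
  then show ?thesis
    by (rule order_trans) simp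
next
  case False
  define k where "k = (LEAST k. v \<le> 2 ^ k)"
  obtain m where "v < 2 ^ m"
    using real_arch_pow[of 2 v] by auto
  then have k: "v \<le> 2 ^ k"
    unfolding k_def by (intro LeastI[of "\<lambda>k. v \<le> 2 ^ k" m]) simp
  with False have "k \<noteq> 0"
    by (intro notI) simp
  then obtain j where j: "k = Suc j"
    by (cases k) auto
  have term_le: "f j \<le> (\<Sum>j. f j)" for f :: "nat \<Rightarrow> ennreal"
    using sum_le_suminf[of f "{j}"] by simp
  have "\<not> v \<le> 2 ^ j"
    using not_less_Least[of j "\<lambda>k. v \<le> 2 ^ k"] j by (auto simp: k_def)
  then have "ennreal v \<le> ennreal (2 ^ Suc j) * indicator {2 ^ j<..} v"
    using k j by (simp add: ennreal_leI del: power_Suc)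
  also have "\<dots> \<le> (\<Sum>j. ennreal (2 ^ Suc j) * indicator {2 ^ j<..} v)"
    by (rule term_le)
  also have "\<dots> \<le> 1 + \<dots>"
    by simp
  finally show ?thesis .
qed

text \<open>
  The level \<open>2 ^ j\<close> of \<open>exp (t\<^sup>2 / (4 * \<sigma>))\<close> is exceeded with probability at most \<open>2 * 4\<^sup>-\<^sup>j\<close>, half
  of the exponent \<open>1 / (2 * \<sigma>)\<close> being given up to gain the square. The layers of height \<open>2 ^ Suc j\<close>
  thus contribute at most \<open>4 * 2\<^sup>-\<^sup>j\<close> each, \<open>8\<close> in total, on top of the values up to \<open>1\<close>.
\<close>

lemma SubG_exp_moment_le:
  assumes G: "G \<in> SubG \<sigma>" and \<sigma>: "\<sigma> > 0"
  shows "(\<integral>\<^sup>+ t. ennreal (exp (t\<^sup>2 / (4 * \<sigma>))) \<partial>G) \<le> 9"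
proof -
  interpret G: prob_space G
    using G by (rule SubG_imp_prob_space)
  have [measurable_cong]: "sets G = sets borel"
    using G by (rule SubG_imp_sets)
  have space_G: "space G = UNIV"
    using sets_eq_imp_space_eq[OF \<open>sets G = sets borel\<close>] by simp
  let ?V = "\<lambda>t::real. exp (t\<^sup>2 / (4 * \<sigma>))"
  have tail: "emeasure G {t. 2 ^ j < ?V t} \<le> ennreal (2 * (1/4) ^ j)" for j :: nat
  proof (cases "j = 0")
    \<comment> \<open>The subgaussian bound speaks only of \<open>t > 0\<close>, but here it would exceed \<open>1\<close> anyway.\<close>
    case True
    have "emeasure G {t. 2 ^ j < ?V t} \<le> 1"
      by (simp add: G.emeasure_eq_measure)
    also have "1 \<le> ennreal (2 * (1/4) ^ j)"
      using True by simp
    finally show ?thesis .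
  next
    case False
    define t where "t = sqrt (4 * \<sigma> * (j * ln 2))"
    have t: "t > 0" "t\<^sup>2 = 4 * \<sigma> * (j * ln 2)"
      using \<sigma> False by (auto simp: t_def)
    have "{u. 2 ^ j < ?V u} = - {-t..t}"
    proof (intro set_eqI)
      fix u
      have "2 ^ j < ?V u \<longleftrightarrow> ln (2 ^ j) < u\<^sup>2 / (4 * \<sigma>)"
        by (subst ln_less_cancel_iff[symmetric]) auto
      also have "\<dots> \<longleftrightarrow> t\<^sup>2 < u\<^sup>2"
        using \<sigma> by (simp add: t ln_realpow field_simps)
      also have "\<dots> \<longleftrightarrow> \<bar>t\<bar> < \<bar>u\<bar>"
        by (meson abs_le_square_iff not_le)
      also have "\<dots> \<longleftrightarrow> u \<in> - {-t..t}"
        using t by auto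
      finally show "u \<in> {u. 2 ^ j < ?V u} \<longleftrightarrow> u \<in> - {-t..t}"
        by simp
    qed
    then have "measure G {u. 2 ^ j < ?V u} \<le> 2 * exp (- t\<^sup>2 / (2 * \<sigma>))"
      using G t(1) by (simp only: SubG_def) auto
    also have "- t\<^sup>2 / (2 * \<sigma>) = j * ln (1/4)"
      using \<sigma> ln_realpow[of 2 2] by (simp add: t field_simps ln_div)
    also have "exp \<dots> = (1/4) ^ j"
      by (simp add: exp_of_nat_mult)
    finally show ?thesis
      by (simp add: G.emeasure_eq_measure ennreal_leI)
  qed
  have "(\<integral>\<^sup>+ t. ennreal (?V t) \<partial>G)
      \<le> (\<integral>\<^sup>+ t. 1 + (\<Sum>j. ennreal (2 ^ Suc j) * indicator {2 ^ j<..} (?V t)) \<partial>G)"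
    by (intro nn_integral_mono le_dyadic_layers)
  also have "\<dots> = 1 + (\<Sum>j. \<integral>\<^sup>+ t. ennreal (2 ^ Suc j) * indicator {2 ^ j<..} (?V t) \<partial>G)"
    by (subst nn_integral_add, measurable, subst nn_integral_suminf, measurable)
       (simp add: G.emeasure_space_1)
  also have "(\<lambda>j. \<integral>\<^sup>+ t. ennreal (2 ^ Suc j) * indicator {2 ^ j<..} (?V t) \<partial>G)
      = (\<lambda>j. ennreal (2 ^ Suc j) * emeasure G {t. 2 ^ j < ?V t})" (is "?f = ?g")
  proof
    fix j
    have "?f j = ennreal (2 ^ Suc j) * (\<integral>\<^sup>+ t. indicator {t. 2 ^ j < ?V t} t \<partial>G)"
      by (subst nn_integral_cmult[symmetric]) (auto intro!: nn_integral_cong simp: indicator_def)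
    also have "\<dots> = ?g j"
      by (subst nn_integral_indicator) (use space_G in measurable)
    finally show "?f j = ?g j" .
  qed
  also have "(\<Sum>j. ennreal (2 ^ Suc j) * emeasure G {t. 2 ^ j < ?V t})
      \<le> (\<Sum>j. ennreal (4 * (1/2) ^ j))"
  proof (intro suminf_le)
    fix j :: nat
    have "ennreal (2 ^ Suc j) * emeasure G {t. 2 ^ j < ?V t}
        \<le> ennreal (2 ^ Suc j) * ennreal (2 * (1/4) ^ j)"
      by (intro mult_left_mono tail) auto
    also have "\<dots> = ennreal (4 * (2 ^ j * (1/4) ^ j))"
      by (subst ennreal_mult[symmetric]) (auto simp: mult_ac)
    also have "2 ^ j * (1/4) ^ j = (1/2 :: real) ^ j"
      by (simp flip: power_mult_distrib)
    finally show "ennreal (2 ^ Suc j) * emeasure G {t. 2 ^ j < ?V t} \<le> ennreal (4 * (1/2) ^ j)" .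
  qed auto
  also have "(\<Sum>j. ennreal (4 * (1/2) ^ j)) = ennreal (\<Sum>j. 4 * (1/2) ^ j)"
    by (intro suminf_ennreal2) (auto intro!: summable_mult summable_geometric)
  also have "(\<Sum>j. 4 * (1/2) ^ j) = (8 :: real)"
    by (subst suminf_mult) (auto simp: suminf_geometric intro!: summable_geometric)
  finally show ?thesis
    by (simp add: add_left_mono)
qed

text \<open>
  The power \<open>18\<close> serves two purposes. It brings the mean of \<open>exp (t\<^sup>2 / (2 * s))\<close> itself below
  \<open>3/2\<close>, and it exceeds \<open>16 + 1\<close>: in \<open>sum_le_truncated_or_power\<close>, \<open>16\<close> factors above
  \<open>root 4 n\<close> supply \<open>n ^ 4\<close>, and one more factor is the quantity to be bounded. Since
  \<open>18 / (2 * s) \<le> 1 / (4 * \<sigma>)\<close> is needed, \<open>s\<close> has to be at least \<open>36 * \<sigma>\<close>.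
\<close>

lemma SubG_exp_power_moment_le:
  assumes G: "G \<in> SubG \<sigma>" and \<sigma>: "\<sigma> > 0" and s: "36 * \<sigma> \<le> s"
  shows "(\<integral>\<^sup>+ t. ennreal (exp (t\<^sup>2 / (2 * s)) ^ 18) \<partial>G) \<le> 9"
proof -
  have "(\<integral>\<^sup>+ t. ennreal (exp (t\<^sup>2 / (2 * s)) ^ 18) \<partial>G) \<le> (\<integral>\<^sup>+ t. ennreal (exp (t\<^sup>2 / (4 * \<sigma>))) \<partial>G)"
  proof (intro nn_integral_mono ennreal_leI)
    fix t :: real
    have "t\<^sup>2 * (36 * \<sigma>) \<le> t\<^sup>2 * s"
      using s by (intro mult_left_mono) auto
    then have "18 * (t\<^sup>2 / (2 * s)) \<le> t\<^sup>2 / (4 * \<sigma>)"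
      using \<sigma> s by (simp add: field_simps)
    then show "exp (t\<^sup>2 / (2 * s)) ^ 18 \<le> exp (t\<^sup>2 / (4 * \<sigma>))"
      by (simp flip: exp_of_nat_mult)
  qed
  also have "\<dots> \<le> 9"
    using G \<sigma> by (rule SubG_exp_moment_le)
  finally show ?thesis .
qed

text \<open>
  By Bernoulli's inequality \<open>x \<le> 1 + (x ^ 18 - 1) / 18\<close>, so a moderate bound on the eighteenth
  moment pushes the mean close to \<open>1\<close>. Any constant below \<open>2\<close> would leave room for the concentration
  argument.
\<close>

lemma SubG_exp_mean_le:
  assumes G: "G \<in> SubG \<sigma>" and \<sigma>: "\<sigma> > 0" and s: "36 * \<sigma> \<le> s"
  shows "(\<integral>\<^sup>+ t. ennreal (exp (t\<^sup>2 / (2 * s))) \<partial>G) \<le> 3/2"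
proof -
  interpret G: prob_space G
    using G by (rule SubG_imp_prob_space)
  have [measurable_cong]: "sets G = sets borel"
    using G by (rule SubG_imp_sets)
  let ?X = "\<lambda>t::real. exp (t\<^sup>2 / (2 * s))"
  have "(\<integral>\<^sup>+ t. ennreal (?X t) \<partial>G) \<le> (\<integral>\<^sup>+ t. ennreal (17/18) + ennreal (1/18) * ennreal (?X t ^ 18) \<partial>G)"
  proof (intro nn_integral_mono)
    fix t
    have "-1 \<le> ?X t - 1"
      by simp
    from Bernoulli_inequality[OF this, of 18]
    have "?X t \<le> 17/18 + 1/18 * ?X t ^ 18"
      by simp
    then have "ennreal (?X t) \<le> ennreal (17/18 + 1/18 * ?X t ^ 18)"
      by (rule ennreal_leI)
    also have "\<dots> = ennreal (17/18) + ennreal (1/18) * ennreal (?X t ^ 18)"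
      by (subst ennreal_plus, simp, simp, subst ennreal_mult) simp_all
    finally show "ennreal (?X t) \<le> \<dots>" .
  qed
  also have "\<dots> = ennreal (17/18) + ennreal (1/18) * (\<integral>\<^sup>+ t. ennreal (?X t ^ 18) \<partial>G)"
    by (subst nn_integral_add, measurable, subst nn_integral_cmult, measurable)
       (simp add: G.emeasure_space_1)
  also have "\<dots> \<le> ennreal (17/18) + ennreal (1/18) * ennreal 9"
    using SubG_exp_power_moment_le[OF G \<sigma> s] by (intro add_left_mono mult_left_mono) auto
  also have "\<dots> = ennreal (17/18 + 1/18 * 9)"
    by (subst ennreal_plus, simp, simp, subst ennreal_mult) simp_all
  also have "\<dots> \<le> ennreal (3/2)"
    by (intro ennreal_leI) simp
  also have "\<dots> = 3/2"
    by (simp add: ennreal_divide_numeral[symmetric])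
  finally show ?thesis .
qed

section \<open>Empirical laws of subgaussian samples\<close>

text \<open>Markov's inequality under the empirical law, at level \<open>exp (t\<^sup>2 / (2 * s))\<close>.\<close>

lemma empirical_in_SubG:
  fixes \<theta> :: "nat \<Rightarrow> real"
  assumes n: "n \<ge> 1" and s: "s > 0"
    and sum_le: "(\<Sum>i<n. exp ((\<theta> i)\<^sup>2 / (2 * s))) \<le> 2 * n"
  shows "empirical n \<theta> \<in> SubG s"
proof -
  have meas: "\<theta> \<in> measurable (uniform_count_measure {..<n}) borel"
    by (simp add: measurable_def sets_uniform_count_measure space_uniform_count_measure)
  interpret U: prob_space "uniform_count_measure {..<n}"
    using n by (intro prob_space_uniform_count_measure) (auto simp: lessThan_empty_iff)
  have "measure (empirical n \<theta>) (- {-t..t}) \<le> 2 * exp (- t\<^sup>2 / (2 * s))" if t: "t > 0" for t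
  proof -
    have "measure (empirical n \<theta>) (- {-t..t}) = real (card (\<theta> -` (- {-t..t}) \<inter> {..<n})) / n"
      unfolding empirical_def
      by (subst measure_distr[OF meas])
         (auto simp: space_uniform_count_measure measure_uniform_count_measure)
    also have "real (card (\<theta> -` (- {-t..t}) \<inter> {..<n})) = (\<Sum>i<n. indicator (- {-t..t}) (\<theta> i))"
      by (simp add: indicator_def sum.If_cases Int_def vimage_def conj_commute)
    also have "\<dots> \<le> (\<Sum>i<n. exp ((\<theta> i)\<^sup>2 / (2 * s)) * exp (- t\<^sup>2 / (2 * s)))"
    proof (intro sum_mono)
      fix i
      show "indicator (- {-t..t}) (\<theta> i) \<le> exp ((\<theta> i)\<^sup>2 / (2 * s)) * exp (- t\<^sup>2 / (2 * s))"
      proof (cases "\<theta> i \<in> - {-t..t}")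
        case True
        then have "\<bar>t\<bar> \<le> \<bar>\<theta> i\<bar>"
          using t by auto
        then have "t\<^sup>2 \<le> (\<theta> i)\<^sup>2"
          by (simp add: abs_le_square_iff)
        then show ?thesis
          using s True by (simp add: field_simps flip: exp_add)
      qed auto
    qed
    also have "\<dots> = (\<Sum>i<n. exp ((\<theta> i)\<^sup>2 / (2 * s))) * exp (- t\<^sup>2 / (2 * s))"
      by (simp add: sum_distrib_right)
    also have "\<dots> \<le> 2 * n * exp (- t\<^sup>2 / (2 * s))"
      by (intro mult_right_mono sum_le) auto
    finally show ?thesis
      using n by (simp add: field_simps)
  qed
  moreover have "prob_space (empirical n \<theta>)"
    unfolding empirical_def by (rule U.prob_space_distr[OF meas])
  ultimately show ?thesis
    by (auto simp: SubG_def empirical_def)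
qed

lemma indep_vars_PiM_coordinates:
  assumes M: "\<And>i. i \<in> I \<Longrightarrow> prob_space (M i)" and "I \<noteq> {}"
  shows "prob_space.indep_vars (Pi\<^sub>M I M) M (\<lambda>i \<omega>. \<omega> i) I"
proof -
  interpret P: prob_space "Pi\<^sub>M I M"
    by (rule prob_space_PiM) fact
  have "distr (Pi\<^sub>M I M) (Pi\<^sub>M I M) (\<lambda>x. \<lambda>i\<in>I. x i) = distr (Pi\<^sub>M I M) (Pi\<^sub>M I M) (\<lambda>x. x)"
    by (intro distr_cong) (auto simp: space_PiM)
  also have "\<dots> = Pi\<^sub>M I M"
    by (simp add: distr_id2)
  also have "\<dots> = (\<Pi>\<^sub>M i\<in>I. distr (Pi\<^sub>M I M) (M i) (\<lambda>x. x i))"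
    by (intro PiM_cong refl distr_PiM_component[symmetric] M)
  finally show ?thesis
    by (subst P.indep_vars_iff_distr_eq_PiM') (use \<open>I \<noteq> {}\<close> in auto)
qed

lemma nn_integral_PiM_coordinate:
  assumes "\<And>i. i \<in> I \<Longrightarrow> prob_space (M i)" "i \<in> I" "f \<in> borel_measurable (M i)"
  shows "(\<integral>\<^sup>+ \<omega>. f (\<omega> i) \<partial>Pi\<^sub>M I M) = (\<integral>\<^sup>+ x. f x \<partial>M i)"
proof -
  have "(\<integral>\<^sup>+ \<omega>. f (\<omega> i) \<partial>Pi\<^sub>M I M) = (\<integral>\<^sup>+ x. f x \<partial>distr (Pi\<^sub>M I M) (M i) (\<lambda>\<omega>. \<omega> i))"
    using assms by (subst nn_integral_distr) auto
  then show ?thesis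
    using assms by (simp add: distr_PiM_component)
qed

text \<open>
  With the truncation level \<open>B = root 4 n\<close>, a deviation of \<open>n / 2\<close> above the mean has by Hoeffding
  probability at most \<open>exp (- 2 * (n / 2)\<^sup>2 / (n * B\<^sup>2)) = exp (- B\<^sup>2 / 2)\<close>, which decays faster than
  any power of \<open>n\<close>. The cube is what the later estimates need.
\<close>

lemma prob_truncated_sum_gt_le:
  fixes X :: "real \<Rightarrow> real"
  assumes G: "prob_space G" and n: "n \<ge> 1"
    and X[measurable]: "X \<in> borel_measurable G" and X_ge: "\<And>t. 0 \<le> X t"
    and mean: "(\<integral>\<^sup>+ t. ennreal (X t) \<partial>G) \<le> 3/2"
  shows "measure (Pi\<^sub>M {..<n} (\<lambda>_. G)) {\<theta> \<in> space (Pi\<^sub>M {..<n} (\<lambda>_. G)).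
             2 * real n < (\<Sum>i<n. min (X (\<theta> i)) (root 4 n))} \<le> 12 ^ 6 / real n ^ 3"
proof -
  define B where "B = root 4 (real n)"
  have B: "B > 0" and B4: "B ^ 4 = n"
    using n by (auto simp: B_def)
  let ?P = "Pi\<^sub>M {..<n} (\<lambda>_. G)"
  let ?Y = "\<lambda>i \<theta>. min (X (\<theta> i)) B"
  interpret G: prob_space G by fact
  interpret P: prob_space ?P
    by (intro prob_space_PiM G)
  have "P.indep_vars (\<lambda>_. borel) ?Y {..<n}"
    by (rule P.indep_vars_compose2[OF indep_vars_PiM_coordinates, where Y = "\<lambda>_ t. min (X t) B"])
       (use n G in \<open>auto simp: lessThan_empty_iff\<close>)
  then interpret H: indep_interval_bounded_random_variables ?P "{..<n}" ?Y "\<lambda>_. 0" "\<lambda>_. B"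
    by unfold_locales (use B X_ge in auto)
  interpret H: Hoeffding_ineq ?P "{..<n}" ?Y "\<lambda>_. 0" "\<lambda>_. B" "\<Sum>i<n. P.expectation (?Y i)"
    by unfold_locales auto
  have E: "P.expectation (?Y i) \<le> 3/2" if i: "i < n" for i
  proof -
    have "ennreal (P.expectation (?Y i)) = (\<integral>\<^sup>+ \<theta>. ennreal (?Y i \<theta>) \<partial>?P)"
      using X_ge B i
      by (intro nn_integral_eq_integral[symmetric] P.integrable_const_bound[of _ B]) auto
    also have "\<dots> = (\<integral>\<^sup>+ t. ennreal (min (X t) B) \<partial>G)"
      using nn_integral_PiM_coordinate[of "{..<n}" "\<lambda>_. G" i "\<lambda>t. ennreal (min (X t) B)"] G i
      by simp
    also have "\<dots> \<le> (\<integral>\<^sup>+ t. ennreal (X t) \<partial>G)"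
      by (intro nn_integral_mono ennreal_leI) auto
    also note mean
    also have "(3/2 :: ennreal) = ennreal (3/2)"
      by (simp add: ennreal_divide_numeral[symmetric])
    finally show ?thesis
      by simp
  qed
  have "(\<Sum>i<n. P.expectation (?Y i)) \<le> (\<Sum>i<n. 3/2)"
    by (intro sum_mono E) auto
  then have "(\<Sum>i<n. P.expectation (?Y i)) + n / 2 \<le> 2 * n"
    by simp
  then have "P.prob {\<theta> \<in> space ?P. 2 * real n < (\<Sum>i<n. ?Y i \<theta>)}
      \<le> P.prob {\<theta> \<in> space ?P. (\<Sum>i<n. P.expectation (?Y i)) + n / 2 \<le> (\<Sum>i<n. ?Y i \<theta>)}"
    by (intro P.finite_measure_mono) auto
  also have "\<dots> \<le> exp (- 2 * (n / 2)\<^sup>2 / (\<Sum>i<n. (B - 0)\<^sup>2))"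
    by (rule H.Hoeffding_ineq_ge) (use n B in auto)
  also have "- 2 * (n / 2)\<^sup>2 / (\<Sum>i<n. (B - 0)\<^sup>2) = - (B\<^sup>2 / 2)"
    using B n by (simp add: field_simps power2_eq_square B4[symmetric] eval_nat_numeral)
  also have "exp (- (B\<^sup>2 / 2)) \<le> 12 ^ 6 / real n ^ 3"
  proof -
    \<comment> \<open>Six factors \<open>exp (B\<^sup>2 / 12)\<close>, each at least \<open>B\<^sup>2 / 12\<close>, give \<open>B ^ 12 = n ^ 3\<close>.\<close>
    have "real n ^ 3 / 12 ^ 6 = (B\<^sup>2 / 12) ^ 6"
      by (simp add: B4[symmetric] power_divide flip: power_mult)
    also have "\<dots> \<le> exp (B\<^sup>2 / 12) ^ 6"
      using exp_ge_add_one_self[of "B\<^sup>2 / 12"] by (intro power_mono) (linarith, simp)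
    also have "\<dots> = exp (B\<^sup>2 / 2)"
      by (simp flip: exp_of_nat_mult)
    finally have "1 / exp (B\<^sup>2 / 2) \<le> 1 / (real n ^ 3 / 12 ^ 6)"
      using n by (intro divide_left_mono) auto
    then show ?thesis
      by (simp add: exp_minus inverse_eq_divide)
  qed
  finally show ?thesis
    by (simp add: B_def)
qed

section \<open>Risks in the normal means model\<close>

lemma prob_space_normal_means: "prob_space (normal_means \<theta>)"
  unfolding normal_means_def by (rule prob_space_normal_density) simp

lemma sets_normal_means [measurable_cong]: "sets (normal_means \<theta>) = sets borel"
  by (simp add: normal_means_def)

definition scalar_risk :: "(real \<Rightarrow> real) \<Rightarrow> real \<Rightarrow> ennreal" where
  "scalar_risk f \<theta> = (\<integral>\<^sup>+ y. ennreal ((f y - \<theta>)\<^sup>2) \<partial>normal_means \<theta>)"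

lemma measurable_scalar_risk [measurable]:
  assumes [measurable]: "f \<in> borel_measurable borel"
  shows "scalar_risk f \<in> borel_measurable borel"
proof -
  have "scalar_risk f
      = (\<lambda>\<theta>. \<integral>\<^sup>+ y. ennreal (exp (- (y - \<theta>)\<^sup>2 / 2) / sqrt (2 * pi)) * ennreal ((f y - \<theta>)\<^sup>2) \<partial>lborel)"
    unfolding scalar_risk_def normal_means_def
    by (subst nn_integral_density) (auto simp: normal_density_def)
  also have "\<dots> \<in> borel_measurable borel"
    by measurable
  finally show ?thesis .
qed

lemma mmse_eq_INF_scalar_risk:
  "mmse normal_means G = (INF f \<in> borel_measurable borel. \<integral>\<^sup>+ \<theta>. scalar_risk f \<theta> \<partial>G)"
  by (simp add: mmse_def scalar_risk_def)

text \<open>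
  For a fixed \<open>f\<close> the right-hand side is a sum of measurable functions of single coordinates, so it
  can be integrated over random \<open>\<theta>\<close> without any measurability of the \<open>mmse\<close> in the prior.
\<close>

lemma mmse_empirical_le:
  assumes n: "n \<ge> 1" and f[measurable]: "f \<in> borel_measurable borel"
  shows "of_nat n * mmse normal_means (empirical n \<theta>) \<le> (\<Sum>i<n. scalar_risk f (\<theta> i))"
proof -
  have meas: "\<theta> \<in> measurable (uniform_count_measure {..<n}) borel"
    by (simp add: measurable_def sets_uniform_count_measure space_uniform_count_measure)
  have "of_nat n * mmse normal_means (empirical n \<theta>)
      \<le> of_nat n * (\<integral>\<^sup>+ t. scalar_risk f t \<partial>empirical n \<theta>)"
    unfolding mmse_eq_INF_scalar_risk by (intro mult_left_mono INF_lower f) auto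
  also have "(\<integral>\<^sup>+ t. scalar_risk f t \<partial>empirical n \<theta>)
      = (\<integral>\<^sup>+ i. scalar_risk f (\<theta> i) \<partial>uniform_count_measure {..<n})"
    unfolding empirical_def using meas by (subst nn_integral_distr) auto
  also have "\<dots> = (\<Sum>i<n. ennreal (1 / n) * scalar_risk f (\<theta> i))"
    unfolding uniform_count_measure_def
    by (subst nn_integral_point_measure_finite) (auto simp: mult.commute)
  also have "of_nat n * \<dots> = (\<Sum>i<n. (of_nat n * ennreal (1 / n)) * scalar_risk f (\<theta> i))"
    by (simp add: sum_distrib_left mult.assoc)
  also have "of_nat n * ennreal (1 / n) = 1"
    using n by (simp add: ennreal_of_nat_eq_real_of_nat flip: ennreal_mult)
  finally show ?thesis
    by simp
qed

lemma mmse_normal_means_finite: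
  assumes G: "prob_space G"
  shows "mmse normal_means G < \<infinity>"
proof -
  interpret G: prob_space G by fact
  \<comment> \<open>The estimator \<open>f y = y\<close> has the variance of the noise as its risk.\<close>
  have risk: "scalar_risk (\<lambda>y. y) \<theta> = 1" for \<theta>
  proof -
    interpret N: prob_space "normal_means \<theta>"
      by (rule prob_space_normal_means)
    have "integrable (normal_means \<theta>) (\<lambda>y. (y - \<theta>)\<^sup>2)"
      using integrable_normal_moment[of 1 \<theta> 2] unfolding normal_means_def
      by (subst integrable_density) auto
    moreover have "(\<integral>y. (y - \<theta>)\<^sup>2 \<partial>normal_means \<theta>) = 1"
      using integral_normal_moment_even[of 1 \<theta> 1] unfolding normal_means_def
      by (subst integral_density) auto
    ultimately show ?thesis
      unfolding scalar_risk_def by (subst nn_integral_eq_integral) auto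
  qed
  have "mmse normal_means G \<le> (\<integral>\<^sup>+ \<theta>. scalar_risk (\<lambda>y. y) \<theta> \<partial>G)"
    unfolding mmse_eq_INF_scalar_risk by (intro INF_lower) auto
  also have "\<dots> = 1"
    by (simp add: risk G.emeasure_space_1)
  finally show ?thesis
    by (auto intro: le_less_trans)
qed

definition clip :: "nat \<Rightarrow> real \<Rightarrow> ((nat \<Rightarrow> real) \<Rightarrow> (nat \<Rightarrow> real)) \<Rightarrow> (nat \<Rightarrow> real) \<Rightarrow> (nat \<Rightarrow> real)" where
  "clip n L est y = (\<lambda>i\<in>{..<n}. max (- L) (min L (est y i)))"

lemma clip_in_estimators:
  assumes "est \<in> estimators n"
  shows "clip n L est \<in> estimators n"
proof -
  have est: "est \<in> measurable (Pi\<^sub>M {..<n} (\<lambda>_. borel)) (Pi\<^sub>M {..<n} (\<lambda>_. borel :: real measure))"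
    using assms by (simp add: estimators_def)
  have [measurable]: "(\<lambda>y. est y i) \<in> borel_measurable (Pi\<^sub>M {..<n} (\<lambda>_. borel))" if "i < n" for i
    using measurable_compose[OF est measurable_component_singleton[of i]] that by simp
  show ?thesis
    unfolding estimators_def clip_def by (intro measurable_restrict) simp
qed

text \<open>Projecting onto an interval that contains the true parameter moves every guess closer to it.\<close>

lemma compound_risk_clip_le:
  assumes \<theta>: "\<And>i. i < n \<Longrightarrow> \<bar>\<theta> i\<bar> \<le> L"
  shows "compound_risk P n (clip n L est) \<theta> \<le> compound_risk P n est \<theta>"
  unfolding compound_risk_def
proof (intro nn_integral_mono ennreal_leI power_mono L2_set_nonneg)
  fix y
  have "L2_set (\<lambda>i. clip n L est y i - \<theta> i) {..<n} = L2_set (\<lambda>i. \<bar>clip n L est y i - \<theta> i\<bar>) {..<n}"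
    by (simp add: L2_set_def)
  also have "\<dots> \<le> L2_set (\<lambda>i. \<bar>est y i - \<theta> i\<bar>) {..<n}"
  proof (rule L2_set_mono)
    fix i assume "i \<in> {..<n}"
    with \<theta>[of i] show "\<bar>clip n L est y i - \<theta> i\<bar> \<le> \<bar>est y i - \<theta> i\<bar>"
      by (auto simp: clip_def)
  qed auto
  also have "\<dots> = L2_set (\<lambda>i. est y i - \<theta> i) {..<n}"
    by (simp add: L2_set_def)
  finally show "L2_set (\<lambda>i. clip n L est y i - \<theta> i) {..<n} \<le> L2_set (\<lambda>i. est y i - \<theta> i) {..<n}" .
qed

lemma compound_risk_clip_le_norm:
  assumes P: "\<And>t. prob_space (P t)" and L: "L \<ge> 0"
  shows "compound_risk P n (clip n L est) \<theta> \<le> ennreal (2 * n * L\<^sup>2 + 2 * (\<Sum>i<n. (\<theta> i)\<^sup>2))"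
proof -
  interpret PP: prob_space "Pi\<^sub>M {..<n} (\<lambda>i. P (\<theta> i))"
    by (intro prob_space_PiM P)
  have "(L2_set (\<lambda>i. clip n L est y i - \<theta> i) {..<n})\<^sup>2 \<le> 2 * n * L\<^sup>2 + 2 * (\<Sum>i<n. (\<theta> i)\<^sup>2)" for y
  proof -
    have "(L2_set (\<lambda>i. clip n L est y i - \<theta> i) {..<n})\<^sup>2 = (\<Sum>i<n. (clip n L est y i - \<theta> i)\<^sup>2)"
      by (simp add: L2_set_def sum_nonneg)
    also have "\<dots> \<le> (\<Sum>i<n. 2 * L\<^sup>2 + 2 * (\<theta> i)\<^sup>2)"
    proof (intro sum_mono)
      fix i assume i: "i \<in> {..<n}"
      have "\<bar>clip n L est y i\<bar> \<le> \<bar>L\<bar>"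
        using i L by (auto simp: clip_def)
      then have "(clip n L est y i)\<^sup>2 \<le> L\<^sup>2"
        by (simp only: abs_le_square_iff)
      moreover have "0 \<le> (clip n L est y i + \<theta> i)\<^sup>2"
        by simp
      ultimately show "(clip n L est y i - \<theta> i)\<^sup>2 \<le> 2 * L\<^sup>2 + 2 * (\<theta> i)\<^sup>2"
        unfolding power2_sum power2_diff by linarith
    qed
    also have "\<dots> = 2 * n * L\<^sup>2 + 2 * (\<Sum>i<n. (\<theta> i)\<^sup>2)"
      by (simp add: sum.distrib sum_distrib_left)
    finally show ?thesis .
  qed
  then have "compound_risk P n (clip n L est) \<theta>
      \<le> (\<integral>\<^sup>+ y. ennreal (2 * n * L\<^sup>2 + 2 * (\<Sum>i<n. (\<theta> i)\<^sup>2)) \<partial>Pi\<^sub>M {..<n} (\<lambda>i. P (\<theta> i)))"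
    unfolding compound_risk_def by (intro nn_integral_mono ennreal_leI)
  then show ?thesis
    by (simp add: PP.emeasure_space_1)
qed

section \<open>From compound to Bayes risk\<close>

lemma sum_sq_le_sum_exp:
  fixes \<theta> :: "nat \<Rightarrow> real"
  assumes "s > 0"
  shows "(\<Sum>i<n. (\<theta> i)\<^sup>2) \<le> 2 * s * (\<Sum>i<n. exp ((\<theta> i)\<^sup>2 / (2 * s)))"
proof -
  have "(\<Sum>i<n. (\<theta> i)\<^sup>2) \<le> (\<Sum>i<n. 2 * s * exp ((\<theta> i)\<^sup>2 / (2 * s)))"
  proof (intro sum_mono)
    fix i
    have "(\<theta> i)\<^sup>2 / (2 * s) \<le> exp ((\<theta> i)\<^sup>2 / (2 * s))"
      using exp_ge_add_one_self[of "(\<theta> i)\<^sup>2 / (2 * s)"] by linarith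
    then show "(\<theta> i)\<^sup>2 \<le> 2 * s * exp ((\<theta> i)\<^sup>2 / (2 * s))"
      using assms by (simp add: field_simps)
  qed
  then show ?thesis
    by (simp add: sum_distrib_left)
qed

text \<open>
  The quantity \<open>2 * n\<^sup>2 + (\<Sum>i<n. x i)\<close> is, up to the factor \<open>4 * s\<close>, the loss of a clipped
  estimator when \<open>x i = exp ((\<theta> i)\<^sup>2 / (2 * s))\<close>. If all \<open>x i\<close> are at most \<open>root 4 n\<close>, the truncation
  has no effect and the sum is below \<open>n\<^sup>2\<close>. Otherwise the largest entry \<open>x k\<close> satisfies
  \<open>x k ^ 16 \<ge> n ^ 4\<close>, and \<open>3 * n\<^sup>2 * x k\<close> is absorbed by \<open>x k ^ 18\<close> with \<open>n\<^sup>2\<close> to spare.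
\<close>

lemma sum_le_truncated_or_power:
  fixes x :: "nat \<Rightarrow> real"
  assumes n: "n \<ge> 1" and x: "\<And>i. i < n \<Longrightarrow> 1 \<le> x i" and big: "2 * real n < (\<Sum>i<n. x i)"
  shows "2 * (real n)\<^sup>2 + (\<Sum>i<n. x i) \<le> 3 * (\<Sum>i<n. x i ^ 18) / (real n)\<^sup>2 \<or>
         2 * real n < (\<Sum>i<n. min (x i) (root 4 n)) \<and> 2 * (real n)\<^sup>2 + (\<Sum>i<n. x i) \<le> 3 * (real n)\<^sup>2"
proof (cases "\<forall>i<n. x i \<le> root 4 n")
  case True
  have "root 4 n \<le> n"
  proof -
    have "real n ^ 1 \<le> real n ^ 4"
      using n by (intro power_increasing) auto
    then have "root 4 (real n) \<le> root 4 (real n ^ 4)"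
      by (intro real_root_le_mono) auto
    also have "\<dots> = n"
      by (intro real_root_power_cancel) auto
    finally show ?thesis .
  qed
  then have "(\<Sum>i<n. x i) \<le> (\<Sum>i<n. real n)"
    using True by (intro sum_mono) (auto intro: order_trans)
  then have "2 * (real n)\<^sup>2 + (\<Sum>i<n. x i) \<le> 3 * (real n)\<^sup>2"
    by (simp add: power2_eq_square)
  moreover have "(\<Sum>i<n. min (x i) (root 4 n)) = (\<Sum>i<n. x i)"
    using True by (intro sum.cong) auto
  ultimately show ?thesis
    using big by simp
next
  case False
  have "{..<n} \<noteq> {}" using n by (auto simp: lessThan_empty_iff)
  then have "Max (x ` {..<n}) \<in> x ` {..<n}"
    by (intro Max_in) auto
  then obtain k where k: "k < n" "\<And>i. i < n \<Longrightarrow> x i \<le> x k"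
    using Max_ge[of "x ` {..<n}"] by fastforce
  from False k have "root 4 n < x k"
    by (meson not_le order_less_le_trans)
  then have "root 4 n ^ 16 \<le> x k ^ 16"
    by (intro power_mono) auto
  also have "root 4 n ^ 16 = (root 4 n ^ 4) ^ 4"
    by (subst power_mult[symmetric]) simp
  also have "\<dots> = real n ^ 4"
    by simp
  finally have n4: "real n ^ 4 \<le> x k ^ 16" .
  have xk: "1 \<le> x k"
    using k x by simp
  have "(real n)\<^sup>2 * 1 \<le> (real n)\<^sup>2 * x k"
    using xk by (intro mult_left_mono) auto
  moreover have "(\<Sum>i<n. x i) \<le> (\<Sum>i<n. x k)"
    using k by (intro sum_mono) auto
  moreover have "real n * x k \<le> (real n)\<^sup>2 * x k"
    using n xk by (intro mult_right_mono self_le_power) auto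
  ultimately have "2 * (real n)\<^sup>2 + (\<Sum>i<n. x i) \<le> 3 * ((real n)\<^sup>2 * x k)"
    by simp
  also have "\<dots> = 3 * (real n ^ 4 * x k) / (real n)\<^sup>2"
    using n by (simp add: eval_nat_numeral)
  also have "\<dots> \<le> 3 * (\<Sum>i<n. x i ^ 18) / (real n)\<^sup>2"
  proof -
    have "real n ^ 4 * x k \<le> x k ^ 16 * x k ^ 2"
      using xk n4 by (intro mult_mono) (auto simp: self_le_power)
    also have "\<dots> = x k ^ 18"
      by (simp flip: power_add)
    also have "\<dots> \<le> (\<Sum>i<n. x i ^ 18)"
      using k x by (intro member_le_sum) auto
    finally show ?thesis
      by (intro divide_right_mono mult_left_mono) auto
  qed
  finally show ?thesis
    by simp
qed

text \<open>
  The four summands on the right are the regret, the risk of a competing scalar rule \<open>f\<close>, and the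
  price of the bad event, paid by a high moment if some coordinate is large and by a rare event
  otherwise. Each is measurable in \<open>\<theta>\<close>, whereas the compound risk of \<open>est\<close> is
  controlled only where the empirical law is subgaussian.
\<close>

lemma compound_risk_clip_bound:
  fixes \<theta> :: "nat \<Rightarrow> real" and s :: real
  defines "X \<equiv> \<lambda>t. exp (t\<^sup>2 / (2 * s))"
  assumes n: "n \<ge> 1" and s: "s > 0" and f: "f \<in> borel_measurable borel"
    and good: "empirical n \<theta> \<in> SubG s \<Longrightarrow>
      compound_risk normal_means n est \<theta> \<le> R + of_nat n * mmse normal_means (empirical n \<theta>)"
  shows "compound_risk normal_means n (clip n (2 * sqrt (s * n)) est) \<theta> \<le>
     R + (\<Sum>i<n. scalar_risk f (\<theta> i)) + ennreal (12 * s / (real n)\<^sup>2) * (\<Sum>i<n. ennreal (X (\<theta> i) ^ 18))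
       + ennreal (12 * s * real n ^ 2) * indicator {\<theta>. 2 * real n < (\<Sum>i<n. min (X (\<theta> i)) (root 4 n))} \<theta>"
    (is "?risk \<le> R + ?mean + ?moment + ?tail")
proof (cases "(\<Sum>i<n. X (\<theta> i)) \<le> 2 * n")
  case True
  have "\<bar>\<theta> i\<bar> \<le> 2 * sqrt (s * n)" if i: "i < n" for i
  proof -
    have "(\<theta> i)\<^sup>2 / (2 * s) \<le> X (\<theta> i)"
      using exp_ge_add_one_self[of "(\<theta> i)\<^sup>2 / (2 * s)"] unfolding X_def by linarith
    also have "\<dots> \<le> (\<Sum>i<n. X (\<theta> i))"
      using i by (intro member_le_sum) (auto simp: X_def)
    also note True
    finally have "(\<theta> i)\<^sup>2 \<le> (2 * sqrt (s * n))\<^sup>2"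
      using s by (simp add: field_simps)
    then show ?thesis
      using s by (intro power2_le_imp_le[of "\<bar>\<theta> i\<bar>"]) auto
  qed
  then have "?risk \<le> compound_risk normal_means n est \<theta>"
    by (rule compound_risk_clip_le)
  also have "\<dots> \<le> R + of_nat n * mmse normal_means (empirical n \<theta>)"
    using True n s unfolding X_def by (intro good empirical_in_SubG) auto
  also have "\<dots> \<le> R + ?mean"
    by (intro add_left_mono mmse_empirical_le n f)
  also have "\<dots> \<le> R + ?mean + ?moment + ?tail"
    by (simp add: add.assoc)
  finally show ?thesis .
next
  case False
  let ?S = "\<Sum>i<n. X (\<theta> i)"
  have "?risk \<le> ennreal (2 * real n * (2 * sqrt (s * n))\<^sup>2 + 2 * (\<Sum>i<n. (\<theta> i)\<^sup>2))"
    using s by (intro compound_risk_clip_le_norm prob_space_normal_means) auto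
  also have "2 * real n * (2 * sqrt (s * n))\<^sup>2 + 2 * (\<Sum>i<n. (\<theta> i)\<^sup>2) \<le> 2 * real n * (4 * (s * n)) + 2 * (2 * s * ?S)"
    using s sum_sq_le_sum_exp[OF s, of \<theta> n] by (simp add: X_def power_mult_distrib)
  also have "\<dots> = 4 * s * (2 * (real n)\<^sup>2 + ?S)"
    by (simp add: algebra_simps power2_eq_square)
  finally have risk: "?risk \<le> ennreal (4 * s * (2 * (real n)\<^sup>2 + ?S))"
    by (simp add: ennreal_leI)
  have ge_1: "1 \<le> X t" for t
    using s by (simp add: X_def)
  consider "2 * (real n)\<^sup>2 + ?S \<le> 3 * (\<Sum>i<n. X (\<theta> i) ^ 18) / (real n)\<^sup>2"
    | "2 * real n < (\<Sum>i<n. min (X (\<theta> i)) (root 4 n))" "2 * (real n)\<^sup>2 + ?S \<le> 3 * (real n)\<^sup>2"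
    using sum_le_truncated_or_power[of n "\<lambda>i. X (\<theta> i)"] n ge_1 False by auto
  then have "?risk \<le> ?moment + ?tail"
  proof cases
    case 1
    then have "4 * s * (2 * (real n)\<^sup>2 + ?S) \<le> 4 * s * (3 * (\<Sum>i<n. X (\<theta> i) ^ 18) / (real n)\<^sup>2)"
      using s by (intro mult_left_mono) auto
    also have "\<dots> = 12 * s / (real n)\<^sup>2 * (\<Sum>i<n. X (\<theta> i) ^ 18)"
      by simp
    finally have "?risk \<le> ennreal (12 * s / (real n)\<^sup>2 * (\<Sum>i<n. X (\<theta> i) ^ 18))"
      using risk by (meson ennreal_leI order_trans)
    also have "\<dots> = ?moment"
      using s by (subst ennreal_mult) (auto simp: sum_nonneg X_def)
    finally show ?thesis
      by (rule order_trans) simp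
  next
    case 2
    then have "4 * s * (2 * (real n)\<^sup>2 + ?S) \<le> 4 * s * (3 * (real n)\<^sup>2)"
      using s by (intro mult_left_mono) auto
    then have "?risk \<le> ennreal (12 * s * (real n)\<^sup>2)"
      using risk by (elim order_trans) (simp add: ennreal_leI)
    also have "\<dots> = ?tail"
      using 2 by simp
    finally show ?thesis
      by (rule order_trans) simp
  qed
  also have "\<dots> \<le> R + ?mean + ?moment + ?tail"
    by (simp add: add.assoc add_increasing)
  finally show ?thesis .
qed

text \<open>
  Both price terms integrate to order \<open>s / n\<close>: \<open>n\<close> moments, each at most \<open>9\<close>, have the factor
  \<open>12 * s / n\<^sup>2\<close>, and a probability of at most \<open>12 ^ 6 / n ^ 3\<close> has the factor \<open>12 * s * n\<^sup>2\<close>.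
  The total \<open>12 * 9 + 12 ^ 7 = 35831916\<close> is rounded up to \<open>10 ^ 8\<close>.
\<close>

lemma bayes_risk_clip_bound:
  assumes G: "G \<in> SubG \<sigma>" and \<sigma>: "\<sigma> > 0" and s: "36 * \<sigma> \<le> s" and n: "n \<ge> 1"
    and good: "\<And>\<theta>. \<theta> \<in> {..<n} \<rightarrow>\<^sub>E UNIV \<Longrightarrow> empirical n \<theta> \<in> SubG s \<Longrightarrow>
      compound_risk normal_means n est \<theta> \<le> R + of_nat n * mmse normal_means (empirical n \<theta>)"
  shows "bayes_risk normal_means n (clip n (2 * sqrt (s * n)) est) G
           \<le> R + of_nat n * mmse normal_means G + ennreal (10 ^ 8 * s / n)"
proof -
  interpret G: prob_space G
    using G by (rule SubG_imp_prob_space)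
  have sets_G [measurable_cong]: "sets G = sets borel"
    using G by (rule SubG_imp_sets)
  have space_G: "space G = UNIV"
    using sets_eq_imp_space_eq[OF sets_G] by simp
  let ?P = "Pi\<^sub>M {..<n} (\<lambda>_. G)"
  interpret P: prob_space ?P
    by (intro prob_space_PiM G.prob_space_axioms)
  have s0: "s > 0"
    using \<sigma> s by linarith
  let ?X = "\<lambda>t::real. exp (t\<^sup>2 / (2 * s))"
  let ?F = "{\<theta>. 2 * real n < (\<Sum>i<n. min (?X (\<theta> i)) (root 4 n))}"
  let ?bayes = "bayes_risk normal_means n (clip n (2 * sqrt (s * n)) est) G"
  have coord: "(\<integral>\<^sup>+ \<theta>. h (\<theta> i) \<partial>?P) = (\<integral>\<^sup>+ t. h t \<partial>G)"
    if "i < n" "h \<in> borel_measurable borel" for h :: "real \<Rightarrow> ennreal" and i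
    using nn_integral_PiM_coordinate[of "{..<n}" "\<lambda>_. G" i h] that sets_G G.prob_space_axioms
    by (simp cong: measurable_cong_sets)
  have sum_coord: "(\<integral>\<^sup>+ \<theta>. (\<Sum>i<n. h (\<theta> i)) \<partial>?P) = of_nat n * (\<integral>\<^sup>+ t. h t \<partial>G)"
    if [measurable]: "h \<in> borel_measurable borel" for h :: "real \<Rightarrow> ennreal"
    by (subst nn_integral_sum, measurable) (simp add: coord)
  have tail: "emeasure ?P (?F \<inter> space ?P) \<le> ennreal (12 ^ 6 / real n ^ 3)"
  proof -
    have "measure ?P {\<theta> \<in> space ?P. 2 * real n < (\<Sum>i<n. min (?X (\<theta> i)) (root 4 n))} \<le> 12 ^ 6 / real n ^ 3"
      by (intro prob_truncated_sum_gt_le SubG_exp_mean_le[OF G \<sigma> s] G.prob_space_axioms n) auto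
    then show ?thesis
      by (simp add: P.emeasure_eq_measure ennreal_leI Int_def conj_commute)
  qed
  have bound: "?bayes \<le> R + of_nat n * (\<integral>\<^sup>+ t. scalar_risk f t \<partial>G) + ennreal (10 ^ 8 * s / n)"
    if f[measurable]: "f \<in> borel_measurable borel" for f
  proof -
    let ?mean = "\<lambda>\<theta>. \<Sum>i<n. scalar_risk f (\<theta> i)"
    let ?moment = "\<lambda>\<theta>. ennreal (12 * s / (real n)\<^sup>2) * (\<Sum>i<n. ennreal (?X (\<theta> i) ^ 18))"
    let ?tail = "\<lambda>\<theta>. ennreal (12 * s * (real n)\<^sup>2) * indicator (?F \<inter> space ?P) \<theta>"
    have F [measurable]: "?F \<inter> space ?P \<in> sets ?P"
    proof -
      have "?F \<inter> space ?P = {\<theta> \<in> space ?P. 2 * real n < (\<Sum>i<n. min (?X (\<theta> i)) (root 4 n))}"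
        by auto
      also have "\<dots> \<in> sets ?P"
        by measurable
      finally show ?thesis .
    qed
    have "?bayes \<le> (\<integral>\<^sup>+ \<theta>. R + ?mean \<theta> + ?moment \<theta> + ?tail \<theta> \<partial>?P)"
      unfolding bayes_risk_def
    proof (intro nn_integral_mono)
      fix \<theta> assume \<theta>: "\<theta> \<in> space ?P"
      then have "\<theta> \<in> {..<n} \<rightarrow>\<^sub>E UNIV"
        by (simp add: space_PiM space_G)
      from compound_risk_clip_bound[OF n s0 f good[OF this]] \<theta>
      show "compound_risk normal_means n (clip n (2 * sqrt (s * n)) est) \<theta>
          \<le> R + ?mean \<theta> + ?moment \<theta> + ?tail \<theta>"
        by (simp add: indicator_def)
    qed
    also have "\<dots> = R + of_nat n * (\<integral>\<^sup>+ t. scalar_risk f t \<partial>G)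
        + ennreal (12 * s / (real n)\<^sup>2) * (of_nat n * (\<integral>\<^sup>+ t. ennreal (?X t ^ 18) \<partial>G))
        + ennreal (12 * s * (real n)\<^sup>2) * emeasure ?P (?F \<inter> space ?P)"
      by (simp add: nn_integral_add nn_integral_cmult sum_coord P.emeasure_space_1
          sum_coord[of "\<lambda>t. ennreal (?X t ^ 18)"] del: sum_ennreal)
    also have "\<dots> \<le> R + of_nat n * (\<integral>\<^sup>+ t. scalar_risk f t \<partial>G)
        + ennreal (12 * s / (real n)\<^sup>2) * (of_nat n * ennreal 9)
        + ennreal (12 * s * (real n)\<^sup>2) * ennreal (12 ^ 6 / real n ^ 3)"
      using SubG_exp_power_moment_le[OF G \<sigma> s]
      by (intro add_mono mult_left_mono tail) auto
    also have "\<dots> = R + of_nat n * (\<integral>\<^sup>+ t. scalar_risk f t \<partial>G)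
        + ennreal (12 * s / (real n)\<^sup>2 * (n * 9) + 12 * s * (real n)\<^sup>2 * (12 ^ 6 / real n ^ 3))"
    proof -
      have "ennreal a * (of_nat n * ennreal 9) + ennreal b * ennreal c = ennreal (a * (n * 9) + b * c)"
        if "0 \<le> a" "0 \<le> b" "0 \<le> c" for a b c
        using that by (simp add: ennreal_of_nat_eq_real_of_nat ennreal_mult del: ennreal_numeral)
      from this[of "12 * s / (real n)\<^sup>2" "12 * s * (real n)\<^sup>2" "12 ^ 6 / real n ^ 3"] show ?thesis
        using s0 by (simp only: add.assoc) simp
    qed
    also have "12 * s / (real n)\<^sup>2 * (n * 9) + 12 * s * (real n)\<^sup>2 * (12 ^ 6 / real n ^ 3) = 35831916 * s / n"
      using n by (simp add: field_simps eval_nat_numeral)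
    also have "R + of_nat n * (\<integral>\<^sup>+ t. scalar_risk f t \<partial>G) + ennreal (35831916 * s / n)
        \<le> R + of_nat n * (\<integral>\<^sup>+ t. scalar_risk f t \<partial>G) + ennreal (10 ^ 8 * s / n)"
      using s0 by (intro add_left_mono ennreal_leI divide_right_mono) auto
    finally show ?thesis .
  qed
  \<comment> \<open>The infimum over \<open>f\<close> is reached by isolating it: \<open>(?bayes - ?c) / n\<close> is a lower bound.\<close>
  have "?bayes \<le> of_nat n * mmse normal_means G + (R + ennreal (10 ^ 8 * s / n))"
  proof (cases "R = top")
    case False
    let ?c = "R + ennreal (10 ^ 8 * s / n)"
    have cancel: "of_nat n * (x / of_nat n) = x" for x :: ennreal
      using n by (simp add: ennreal_times_divide mult.commute[of _ x] ennreal_mult_divide_eq)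
    have c: "?c \<noteq> top"
      using False by simp
    have "(?bayes - ?c) / of_nat n \<le> mmse normal_means G"
      unfolding mmse_eq_INF_scalar_risk
    proof (intro INF_greatest)
      fix f :: "real \<Rightarrow> real" assume "f \<in> borel_measurable borel"
      from bound[OF this] have "?bayes - ?c \<le> of_nat n * (\<integral>\<^sup>+ t. scalar_risk f t \<partial>G)"
        using c by (simp add: ennreal_minus_le_iff ac_simps)
      then show "(?bayes - ?c) / of_nat n \<le> (\<integral>\<^sup>+ t. scalar_risk f t \<partial>G)"
        using n by (intro divide_le_posI_ennreal) auto
    qed
    then have "of_nat n * ((?bayes - ?c) / of_nat n) \<le> of_nat n * mmse normal_means G"
      by (intro mult_left_mono) auto
    then have "?bayes - ?c \<le> of_nat n * mmse normal_means G"
      by (simp only: cancel)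
    then show ?thesis
      using c by (simp add: ennreal_minus_le_iff ac_simps)
  qed simp
  then show ?thesis
    by (simp add: ac_simps)
qed

text \<open>
  Regrets are signed, while risks are integrated in \<open>ennreal\<close>. For a finite \<open>m\<close> and a nonnegative
  bound, moving \<open>m\<close> to the other side passes from one to the other; infinite \<open>a\<close> and \<open>\<rho>\<close> are covered.
\<close>

lemma regret_le_iff:
  fixes a m :: ennreal and \<rho> :: ereal
  assumes "m < \<infinity>" "0 \<le> \<rho>"
  shows "enn2ereal a - ereal (real n) * enn2ereal m \<le> \<rho> \<longleftrightarrow> a \<le> e2ennreal \<rho> + of_nat n * m"
proof -
  obtain m' where m: "m = ennreal m'" "0 \<le> m'"
    using assms(1) by (cases m) auto
  show ?thesis
  proof (cases a)
    case (real a')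
    with m assms(2) show ?thesis
      by (cases \<rho>) (auto simp: ennreal_of_nat_eq_real_of_nat algebra_simps
            simp flip: ennreal_mult ennreal_plus)
  next
    case top
    with m assms(2) show ?thesis
      by (cases \<rho>) (auto simp: ennreal_of_nat_eq_real_of_nat top_unique simp flip: ennreal_mult ennreal_plus)
  qed
qed

text \<open>For \<open>\<theta> = 0\<close> the oracle \<open>f y = 0\<close> has no risk, so no estimator beats it.\<close>

lemma compound_regret_nonneg:
  assumes n: "n \<ge> 1" and s: "s > 0"
  shows "0 \<le> (SUP \<theta> \<in> {\<theta> \<in> {..<n} \<rightarrow>\<^sub>E UNIV. empirical n \<theta> \<in> SubG s}.
        enn2ereal (compound_risk normal_means n est \<theta>)
          - ereal (real n) * enn2ereal (mmse normal_means (empirical n \<theta>)))"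
proof -
  define z where "z = (\<lambda>i\<in>{..<n}. 0 :: real)"
  have "empirical n z \<in> SubG s"
    using n s by (intro empirical_in_SubG) (auto simp: z_def)
  moreover have "z \<in> {..<n} \<rightarrow>\<^sub>E UNIV"
    by (auto simp: z_def)
  moreover have "mmse normal_means (empirical n z) = 0"
  proof -
    have "of_nat n * mmse normal_means (empirical n z) \<le> (\<Sum>i<n. scalar_risk (\<lambda>_. 0) (z i))"
      by (rule mmse_empirical_le) (use n in auto)
    also have "\<dots> = 0"
      by (simp add: scalar_risk_def z_def)
    finally show ?thesis
      using n by simp
  qed
  ultimately show ?thesis
    by (intro SUP_upper2[of z]) (auto simp: zero_ennreal.rep_eq)
qed

theorem proposition4:
  "\<exists>c0::real. c0 > 0 \<and>
     (\<forall>s::real. \<forall>n::nat. s > 0 \<longrightarrow> n \<ge> 1 \<longrightarrow>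
        TotRegretComp normal_means n (SubG s)
          \<ge> TotRegret normal_means n (SubG (c0 * s)) - ereal (s / (c0 * real n)))"
proof (intro exI[of _ "1 / 10 ^ 8"] conjI allI impI)
  fix s :: real and n :: nat
  assume s: "s > 0" and n: "n \<ge> 1"
  \<comment> \<open>Two demands on \<open>c0\<close>: at most \<open>1 / 36\<close> for the moments, at most \<open>10\<^sup>-\<^sup>8\<close> for the error term.\<close>
  let ?c0 = "1 / 10 ^ 8 :: real"
  let ?err = "10 ^ 8 * s / n"
  show "TotRegret normal_means n (SubG (?c0 * s)) - ereal (s / (?c0 * real n))
      \<le> TotRegretComp normal_means n (SubG s)"
    unfolding TotRegretComp_def
  proof (intro INF_greatest)
    fix est assume est: "est \<in> estimators n"
    let ?regret = "\<lambda>\<theta>. enn2ereal (compound_risk normal_means n est \<theta>)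
        - ereal (real n) * enn2ereal (mmse normal_means (empirical n \<theta>))"
    let ?\<Theta> = "{\<theta> \<in> {..<n} \<rightarrow>\<^sub>E UNIV. empirical n \<theta> \<in> SubG s}"
    let ?clip = "clip n (2 * sqrt (s * n)) est"
    define \<rho> where "\<rho> = (SUP \<theta> \<in> ?\<Theta>. ?regret \<theta>)"
    have \<rho>: "0 \<le> \<rho>"
      unfolding \<rho>_def using n s by (rule compound_regret_nonneg)
    have good: "compound_risk normal_means n est \<theta>
        \<le> e2ennreal \<rho> + of_nat n * mmse normal_means (empirical n \<theta>)"
      if "\<theta> \<in> {..<n} \<rightarrow>\<^sub>E UNIV" and emp: "empirical n \<theta> \<in> SubG s" for \<theta>
    proof -
      have "?regret \<theta> \<le> \<rho>"
        unfolding \<rho>_def using that by (intro SUP_upper) auto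
      then show ?thesis
        using mmse_normal_means_finite[OF SubG_imp_prob_space[OF emp]] \<rho>
        by (simp add: regret_le_iff)
    qed
    have "TotRegret normal_means n (SubG (?c0 * s)) \<le>
        (SUP G \<in> SubG (?c0 * s). enn2ereal (bayes_risk normal_means n ?clip G)
          - ereal (real n) * enn2ereal (mmse normal_means G))"
      unfolding TotRegret_def by (intro INF_lower clip_in_estimators est)
    also have "\<dots> \<le> \<rho> + ereal ?err"
    proof (intro SUP_least)
      fix G assume G: "G \<in> SubG (?c0 * s)"
      have "bayes_risk normal_means n ?clip G
          \<le> e2ennreal \<rho> + of_nat n * mmse normal_means G + ennreal ?err"
        using s by (intro bayes_risk_clip_bound[OF G] n good) auto
      also have "\<dots> = e2ennreal (\<rho> + ereal ?err) + of_nat n * mmse normal_means G"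
        using \<rho> s by (cases \<rho>) (auto simp: ac_simps)
      finally show "enn2ereal (bayes_risk normal_means n ?clip G)
          - ereal (real n) * enn2ereal (mmse normal_means G) \<le> \<rho> + ereal ?err"
        using mmse_normal_means_finite[OF SubG_imp_prob_space[OF G]] \<rho> s
        by (subst regret_le_iff) auto
    qed
    finally have "TotRegret normal_means n (SubG (?c0 * s)) - ereal ?err \<le> \<rho>"
      by (subst ereal_minus_le_iff) (auto simp: add.commute)
    also have "?err = s / (?c0 * real n)"
      by simp
    finally show "TotRegret normal_means n (SubG (?c0 * s)) - ereal (s / (?c0 * real n))
        \<le> (SUP \<theta> \<in> ?\<Theta>. ?regret \<theta>)"
      by (simp add: \<rho>_def)
  qed
qed simp

end
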